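(* Let $m\in\mathbb Z$ and let $\mathcal U_m$ be the affine scheme over $\mathbb Z$ defined by $x^2+y^2+z^2-xyz=m$. Suppose $\mathcal U_m(A_{\mathbb Z})\neq\emptyset$, where $\mathcal U_m(A_{\mathbb Z})=\mathcal U_m(\mathbb R)\times\prod_{p \text{ prime}}\mathcal U_m(\mathbb Z_p)$. Then for any finite set $S$ of primes, the image of the natural (diagonal) map $\mathcal U_m(\mathbb Z)\to\prod_{p\notin S}\mathcal U_m(\mathbb Z_p)$ is not dense (for the product of the $p$-adic topologies). *)

theory Defs
  imports "HOL-Analysis.Analysis"
begin

text \<open>The ring of p-adic integers Z_p, realised as the inverse limit of the rings Z/p^n Z:
  an element is a compatible sequence of residues x n \<in> {0..<p^n}.\<close>

definition padic_ints :: "nat \<Rightarrow> (nat \<Rightarrow> int) set" where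
  "padic_ints p = {x. (\<forall>n. 0 \<le> x n \<and> x n < int p ^ n) \<and>
                       (\<forall>n. x (Suc n) mod int p ^ n = x n)}"

definition padic_of_int :: "nat \<Rightarrow> int \<Rightarrow> (nat \<Rightarrow> int)" where
  "padic_of_int p k = (\<lambda>n. k mod int p ^ n)"

definition padic_add :: "nat \<Rightarrow> (nat \<Rightarrow> int) \<Rightarrow> (nat \<Rightarrow> int) \<Rightarrow> (nat \<Rightarrow> int)" where
  "padic_add p x y = (\<lambda>n. (x n + y n) mod int p ^ n)"

definition padic_sub :: "nat \<Rightarrow> (nat \<Rightarrow> int) \<Rightarrow> (nat \<Rightarrow> int) \<Rightarrow> (nat \<Rightarrow> int)" where
  "padic_sub p x y = (\<lambda>n. (x n - y n) mod int p ^ n)"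

definition padic_mult :: "nat \<Rightarrow> (nat \<Rightarrow> int) \<Rightarrow> (nat \<Rightarrow> int) \<Rightarrow> (nat \<Rightarrow> int)" where
  "padic_mult p x y = (\<lambda>n. (x n * y n) mod int p ^ n)"

text \<open>The p-adic topology on Z_p: generated by the balls x + p^n Z_p,
  i.e. the sets of elements agreeing with a given one modulo p^n.\<close>

definition padic_topology :: "nat \<Rightarrow> (nat \<Rightarrow> int) topology" where
  "padic_topology p = topology_generated_by
     {{y \<in> padic_ints p. y n = x n} | x n. x \<in> padic_ints p}"

definition markoff_padic :: "nat \<Rightarrow> (nat \<Rightarrow> int) \<Rightarrow> (nat \<Rightarrow> int) \<Rightarrow> (nat \<Rightarrow> int) \<Rightarrow> (nat \<Rightarrow> int)" where
  "markoff_padic p x y z =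
     padic_sub p (padic_add p (padic_add p (padic_mult p x x) (padic_mult p y y)) (padic_mult p z z))
                 (padic_mult p (padic_mult p x y) z)"

definition Um_Zp :: "int \<Rightarrow> nat \<Rightarrow> ((nat \<Rightarrow> int) \<times> (nat \<Rightarrow> int) \<times> (nat \<Rightarrow> int)) set" where
  "Um_Zp m p = {(x, y, z). x \<in> padic_ints p \<and> y \<in> padic_ints p \<and> z \<in> padic_ints p \<and>
                            markoff_padic p x y z = padic_of_int p m}"

definition Um_Zp_topology :: "int \<Rightarrow> nat \<Rightarrow> ((nat \<Rightarrow> int) \<times> (nat \<Rightarrow> int) \<times> (nat \<Rightarrow> int)) topology" where
  "Um_Zp_topology m p = subtopology
     (prod_topology (padic_topology p) (prod_topology (padic_topology p) (padic_topology p)))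
     (Um_Zp m p)"

definition Um_Z :: "int \<Rightarrow> (int \<times> int \<times> int) set" where
  "Um_Z m = {(x, y, z). x^2 + y^2 + z^2 - x*y*z = m}"

definition Um_R :: "int \<Rightarrow> (real \<times> real \<times> real) set" where
  "Um_R m = {(x, y, z). x^2 + y^2 + z^2 - x*y*z = real_of_int m}"

definition diag_map :: "nat set \<Rightarrow> int \<times> int \<times> int \<Rightarrow>
    (nat \<Rightarrow> (nat \<Rightarrow> int) \<times> (nat \<Rightarrow> int) \<times> (nat \<Rightarrow> int))" where
  "diag_map P = (\<lambda>(x, y, z). restrict (\<lambda>p. (padic_of_int p x, padic_of_int p y, padic_of_int p z)) P)"

end

theory Submission
  imports Defs "HOL-Number_Theory.Cong" "HOL-Computational_Algebra.Polynomial"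
begin

text \<open>
  Vieta involutions such as \<open>(x, y, z) \<mapsto> (x, y, x y - z)\<close> act on integral and on \<open>p\<close>-adic
  points alike, and they decrease the height of an integral point whose coordinates are large
  compared with \<open>m\<close> and have a positive product. Hence a nonempty Vieta-invariant set of integral
  points all of whose nonzero coordinates are large must contain the origin.

  If \<open>m \<noteq> 0\<close>, choose large primes \<open>p \<noteq> q\<close> outside \<open>S\<close> modulo which \<open>m\<close> is a square. An integral
  point close to \<open>(\<surd>m, 0, 0)\<close> at \<open>p\<close> and to \<open>(0, \<surd>m, 0)\<close> at \<open>q\<close> satisfies the invariant condition
  \<open>p | y, z\<close> and \<open>q | x, z\<close>, but the origin is not a point of the surface. If \<open>m = 0\<close>, choose \<open>p\<close>
  such that \<open>-1\<close> is a square \<open>r\<^sup>2\<close> in \<open>\<int>\<^sub>p\<close>: the origin is the only integral point divisible by \<open>p\<close>,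
  but \<open>(0, p, p r)\<close> is a \<open>p\<close>-adic one.
\<close>

section \<open>Vieta descent\<close>

definition vieta_closed :: "(int \<times> int \<times> int) set \<Rightarrow> bool" where
  "vieta_closed A \<longleftrightarrow>
     (\<forall>(x, y, z)\<in>A. (y*z - x, y, z) \<in> A \<and> (x, x*z - y, z) \<in> A \<and> (x, y, x*y - z) \<in> A)"

definition height :: "int \<times> int \<times> int \<Rightarrow> nat" where
  "height = (\<lambda>(x, y, z). nat (\<bar>x\<bar> + \<bar>y\<bar> + \<bar>z\<bar>))"

text \<open>The quadratic \<open>t\<^sup>2 - a b t + a\<^sup>2 + b\<^sup>2 - m\<close> has the roots \<open>c\<close> and \<open>a b - c\<close> and is negative at
  the larger one of \<open>a\<close> and \<open>b\<close>.\<close>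

lemma vieta_decreases_max_pos:
  fixes a b c m :: int
  assumes "a^2 + b^2 + c^2 - a*b*c = m"
    and "\<bar>m\<bar> + 4 \<le> a" "\<bar>m\<bar> + 4 \<le> b" "a \<le> c" "b \<le> c"
  shows "\<bar>a*b - c\<bar> < c"
  using assms
proof (induction a b rule: linorder_wlog)
  case (le a b)
  have "(\<bar>m\<bar> + 1) * 1 \<le> (a - 3) * b^2"
    using le.prems by (intro mult_mono) auto
  moreover have "a^2 \<le> b^2"
    using le.hyps le.prems by (intro power_mono) auto
  moreover have "(b - c) * (b - (a*b - c)) = 2*b^2 + a^2 - a*b^2 - m"
    using le.prems(1) by (simp add: algebra_simps power2_eq_square)
  ultimately have "(b - c) * (b - (a*b - c)) < 0"
    by (simp add: algebra_simps)
  then have "a*b - c < b"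
    using \<open>b \<le> c\<close> by (simp add: mult_less_0_iff)
  moreover have "0 < a*b"
    using le.prems by (intro mult_pos_pos) auto
  ultimately show ?case
    using \<open>b \<le> c\<close> by linarith
next
  case (sym a b)
  then show ?case by (simp add: algebra_simps)
qed

lemma vieta_decreases_max:
  assumes "(x, y, z) \<in> Um_Z m" and pos: "0 < x*y*z"
    and large: "\<bar>m\<bar> + 4 \<le> \<bar>x\<bar>" "\<bar>m\<bar> + 4 \<le> \<bar>y\<bar>" and max: "\<bar>x\<bar> \<le> \<bar>z\<bar>" "\<bar>y\<bar> \<le> \<bar>z\<bar>"
  shows "\<bar>x*y - z\<bar> < \<bar>z\<bar>"
proof -
  have "\<bar>x\<bar>*\<bar>y\<bar>*\<bar>z\<bar> = x*y*z"
    using pos by (simp flip: abs_mult)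
  then have "\<bar>\<bar>x\<bar>*\<bar>y\<bar> - \<bar>z\<bar>\<bar> < \<bar>z\<bar>"
    using assms by (intro vieta_decreases_max_pos) (auto simp: Um_Z_def)
  moreover have "0 < x*y \<and> 0 < z \<or> x*y < 0 \<and> z < 0"
    using pos by (simp add: zero_less_mult_iff)
  then have "\<bar>x*y - z\<bar> = \<bar>\<bar>x*y\<bar> - \<bar>z\<bar>\<bar>" by auto
  ultimately show ?thesis
    by (simp add: abs_mult)
qed

lemma vieta_closed_decreases_height:
  assumes closed: "vieta_closed A" and "A \<subseteq> Um_Z m" and xyz: "(x, y, z) \<in> A"
    and pos: "0 < x*y*z" and large: "\<And>t. t \<in> {x, y, z} \<Longrightarrow> \<bar>m\<bar> + 4 \<le> \<bar>t\<bar>"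
  shows "\<exists>w\<in>A. height w < height (x, y, z)"
proof -
  have reflections: "(y*z - x, y, z) \<in> A" "(x, x*z - y, z) \<in> A" "(x, y, x*y - z) \<in> A"
    using closed xyz by (auto simp: vieta_closed_def)
  have permutations: "(x, y, z) \<in> Um_Z m" "(x, z, y) \<in> Um_Z m" "(y, z, x) \<in> Um_Z m"
    using xyz \<open>A \<subseteq> Um_Z m\<close> by (auto simp: Um_Z_def algebra_simps)
  consider (z_max) "\<bar>x\<bar> \<le> \<bar>z\<bar>" "\<bar>y\<bar> \<le> \<bar>z\<bar>"
    | (y_max) "\<bar>x\<bar> \<le> \<bar>y\<bar>" "\<bar>z\<bar> \<le> \<bar>y\<bar>"
    | (x_max) "\<bar>y\<bar> \<le> \<bar>x\<bar>" "\<bar>z\<bar> \<le> \<bar>x\<bar>"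
    by linarith
  then show ?thesis
  proof cases
    case z_max
    then have "\<bar>x*y - z\<bar> < \<bar>z\<bar>"
      using permutations pos large by (intro vieta_decreases_max) auto
    then show ?thesis
      using reflections(3) by (intro bexI) (auto simp: height_def)
  next
    case y_max
    then have "\<bar>x*z - y\<bar> < \<bar>y\<bar>"
      using permutations pos large by (intro vieta_decreases_max) (auto simp: mult_ac)
    then show ?thesis
      using reflections(2) by (intro bexI) (auto simp: height_def)
  next
    case x_max
    then have "\<bar>y*z - x\<bar> < \<bar>x\<bar>"
      using permutations pos large by (intro vieta_decreases_max) (auto simp: mult_ac)
    then show ?thesis
      using reflections(1) by (intro bexI) (auto simp: height_def)
  qed
qed

theorem origin_mem_if_vieta_closed:
  assumes "vieta_closed A" "A \<subseteq> Um_Z m" "A \<noteq> {}"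
    and large: "\<And>x y z t. \<lbrakk>(x, y, z) \<in> A; t \<in> {x, y, z}; t \<noteq> 0\<rbrakk> \<Longrightarrow> \<bar>m\<bar> + 4 \<le> \<bar>t\<bar>"
  shows "(0, 0, 0) \<in> A"
proof -
  obtain w where "w \<in> A \<and> (\<forall>v. v \<in> A \<longrightarrow> height w \<le> height v)"
    using ex_has_least_nat[of "\<lambda>w. w \<in> A" _ height] \<open>A \<noteq> {}\<close> by blast
  moreover obtain x y z where "w = (x, y, z)" by (rule prod_cases3)
  ultimately have xyz: "(x, y, z) \<in> A"
    and minimal: "\<And>v. v \<in> A \<Longrightarrow> height (x, y, z) \<le> height v" by auto
  have "x*y*z \<le> 0"
  proof (rule ccontr)
    assume "\<not> x*y*z \<le> 0"
    then have pos: "0 < x*y*z" by simp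
    then have "\<bar>m\<bar> + 4 \<le> \<bar>t\<bar>" if "t \<in> {x, y, z}" for t
      using large[OF xyz that] pos that by (cases "t = 0") auto
    then obtain w where "w \<in> A" "height w < height (x, y, z)"
      using vieta_closed_decreases_height[OF assms(1,2) xyz pos] by blast
    then show False
      using minimal by (simp flip: not_le)
  qed
  then have "x^2 + y^2 + z^2 \<le> m"
    using xyz \<open>A \<subseteq> Um_Z m\<close> by (auto simp: Um_Z_def)
  then have bounds: "x^2 \<le> m" "y^2 \<le> m" "z^2 \<le> m"
    using zero_le_power2[of x] zero_le_power2[of y] zero_le_power2[of z] by linarith+
  have "t = 0" if "t \<in> {x, y, z}" "t^2 \<le> m" for t
  proof (rule ccontr)
    assume "t \<noteq> 0"
    then have "\<bar>m\<bar> + 4 \<le> \<bar>t\<bar>"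
      using large[OF xyz] that by blast
    moreover have "\<bar>t\<bar> \<le> t^2"
      using self_le_power[of "\<bar>t\<bar>" 2] \<open>t \<noteq> 0\<close> by simp
    ultimately show False
      using \<open>t^2 \<le> m\<close> by linarith
  qed
  then show ?thesis
    using bounds xyz by auto
qed

lemma Um_Z_not_dvd_near_two_axes:
  assumes "m \<noteq> 0" and "(x, y, z) \<in> Um_Z m" and large: "\<bar>m\<bar> + 4 \<le> p" "\<bar>m\<bar> + 4 \<le> q"
  shows "\<not> (p dvd y \<and> p dvd z \<and> q dvd x \<and> q dvd z)"
proof
  assume dvd: "p dvd y \<and> p dvd z \<and> q dvd x \<and> q dvd z"
  let ?A = "{(x, y, z) \<in> Um_Z m. p dvd y \<and> p dvd z \<and> q dvd x \<and> q dvd z}"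
  have "(0, 0, 0) \<in> ?A"
  proof (rule origin_mem_if_vieta_closed)
    show "vieta_closed ?A"
      by (auto simp: vieta_closed_def Um_Z_def algebra_simps power2_eq_square)
    show "?A \<noteq> {}"
      using assms(2) dvd by auto
    show "\<bar>m\<bar> + 4 \<le> \<bar>t\<bar>" if "(x, y, z) \<in> ?A" "t \<in> {x, y, z}" "t \<noteq> 0" for x y z t
      using that large dvd_imp_le_int[of t p] dvd_imp_le_int[of t q] by auto
  qed auto
  then show False
    using \<open>m \<noteq> 0\<close> by (simp add: Um_Z_def)
qed

lemma Um_Z_0_dvd_imp_origin:
  assumes "(x, y, z) \<in> Um_Z 0" and "4 \<le> p" and "p dvd x" "p dvd y" "p dvd z"
  shows "(x, y, z) = (0, 0, 0)"
proof (rule ccontr)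
  assume "(x, y, z) \<noteq> (0, 0, 0)"
  let ?A = "{(x, y, z) \<in> Um_Z 0. p dvd x \<and> p dvd y \<and> p dvd z \<and> (x, y, z) \<noteq> (0, 0, 0)}"
  have "(0, 0, 0) \<in> ?A"
  proof (rule origin_mem_if_vieta_closed)
    show "vieta_closed ?A"
      by (auto simp: vieta_closed_def Um_Z_def algebra_simps power2_eq_square)
    show "?A \<noteq> {}"
      using assms \<open>(x, y, z) \<noteq> (0, 0, 0)\<close> by auto
    show "\<bar>0\<bar> + 4 \<le> \<bar>t\<bar>" if "(x, y, z) \<in> ?A" "t \<in> {x, y, z}" "t \<noteq> 0" for x y z t
      using that \<open>4 \<le> p\<close> dvd_imp_le_int[of t p] by auto
  qed auto
  then show False by simp
qed

section \<open>Prime divisors of polynomial values\<close>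

lemma poly_add_taylor_dvd:
  fixes f :: "'a::idom poly"
  shows "h^2 dvd poly f (x + h) - (poly f x + h * poly (pderiv f) x)"
proof (induction f)
  case 0
  then show ?case by simp
next
  case (pCons a f)
  have "poly (pCons a f) (x + h) - (poly (pCons a f) x + h * poly (pderiv (pCons a f)) x)
      = (x + h) * (poly f (x + h) - (poly f x + h * poly (pderiv f) x)) + h^2 * poly (pderiv f) x"
    by (simp add: pderiv_pCons algebra_simps power2_eq_square)
  then show ?case
    using pCons.IH by simp
qed

lemma diff_dvd_poly_diff:
  fixes f :: "'a::idom poly"
  shows "x - y dvd poly f x - poly f y"
proof -
  have "x - y dvd poly f x - (poly f y + (x - y) * poly (pderiv f) y)"
    using poly_add_taylor_dvd[of "x - y" f y] by (auto simp: power2_eq_square intro: dvd_mult_left)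
  then have "x - y dvd (poly f x - (poly f y + (x - y) * poly (pderiv f) y))
      + (x - y) * poly (pderiv f) y"
    by (rule dvd_add) simp
  then show ?thesis by simp
qed

text \<open>The quotient of \<open>f (c P t)\<close> by \<open>c = f 0\<close> is \<open>1\<close> modulo \<open>P\<close>, so no prime divides it.\<close>

lemma power2_poly_eq_if_prime_divisors_dvd:
  fixes f :: "int poly"
  assumes dvd_P: "\<And>p a. \<lbrakk>prime p; int p dvd poly f a\<rbrakk> \<Longrightarrow> int p dvd P"
  shows "(poly f (poly f 0 * P * t))^2 = (poly f 0)^2"
proof -
  define c where "c = poly f 0"
  have "c * P * t dvd poly f (c * P * t) - c"
    using diff_dvd_poly_diff[of "c * P * t" 0 f] by (simp add: c_def)
  then obtain u where "poly f (c * P * t) - c = c * P * t * u" by blast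
  then have factored: "poly f (c * P * t) = c * (1 + P * (t * u))"
    by (simp add: algebra_simps)
  have "\<bar>1 + P * (t * u)\<bar> = 1"
  proof (rule ccontr)
    assume "\<bar>1 + P * (t * u)\<bar> \<noteq> 1"
    then have "nat \<bar>1 + P * (t * u)\<bar> \<noteq> 1" by linarith
    then obtain p where "prime p" "p dvd nat \<bar>1 + P * (t * u)\<bar>"
      using prime_factor_nat by blast
    then have p: "int p dvd 1 + P * (t * u)"
      by (simp flip: int_dvd_int_iff)
    then have "int p dvd poly f (c * P * t)"
      by (simp add: factored)
    then have "int p dvd P"
      using \<open>prime p\<close> dvd_P by blast
    then have "int p dvd 1"
      using p by (simp add: dvd_add_left_iff)
    then show False
      using \<open>prime p\<close> by simp
  qed
  then have "(1 + P * (t * u))^2 = 1"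
    by (simp add: abs_square_eq_1)
  then show ?thesis
    by (simp add: factored power_mult_distrib flip: c_def)
qed

theorem infinite_prime_divisors_poly:
  fixes f :: "int poly"
  assumes "0 < degree f"
  shows "infinite {p::nat. prime p \<and> (\<exists>a. int p dvd poly f a)}"
proof
  let ?D = "{p::nat. prime p \<and> (\<exists>a. int p dvd poly f a)}"
  assume "finite ?D"
  define c P where "c = poly f 0" and "P = (\<Prod>p\<in>?D. int p)"
  have "P \<noteq> 0"
    using \<open>finite ?D\<close> by (auto simp: P_def)
  have "c \<noteq> 0"
  proof
    assume "c = 0"
    then have "?D = {p. prime p}"
      by (auto simp: c_def intro!: exI[of _ 0])
    then show False
      using \<open>finite ?D\<close> primes_infinite by simp
  qed
  have "int p dvd P" if "p \<in> ?D" for p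
    unfolding P_def using \<open>finite ?D\<close> that by (rule dvd_prodI)
  then have "poly (f^2 - [:c^2:]) (c * P * t) = 0" for t
    using power2_poly_eq_if_prime_divisors_dvd[of f P t] by (auto simp: c_def)
  then have "range (\<lambda>t. c * P * t) \<subseteq> {x. poly (f^2 - [:c^2:]) x = 0}" by auto
  moreover have "infinite (range (\<lambda>t. c * P * t))"
    using \<open>c \<noteq> 0\<close> \<open>P \<noteq> 0\<close> by (simp add: finite_image_iff inj_on_def)
  moreover have "f^2 \<noteq> [:c^2:]"
    using assms degree_power_eq[of f 2] by (cases "f = 0") auto
  ultimately show False
    using poly_roots_finite[of "f^2 - [:c^2:]"] by (auto dest: finite_subset)
qed

section \<open>Hensel's lemma\<close>

text \<open>Newton's iteration with the inverse of the derivative replaced by a fixed \<open>s\<close>.\<close>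

definition newton_step :: "int poly \<Rightarrow> int \<Rightarrow> int \<Rightarrow> int" where
  "newton_step f s x = x - s * poly f x"

lemma newton_step_dvd:
  assumes root: "p ^ Suc n dvd poly f x" and inverse: "p dvd 1 - s * poly (pderiv f) x"
  shows "p ^ Suc (Suc n) dvd poly f (newton_step f s x)"
proof -
  define h where "h = - (s * poly f x)"
  have "p ^ Suc (Suc n) dvd p ^ Suc (Suc n) * p ^ n" by simp
  also have "\<dots> = (p ^ Suc n)^2"
    by (simp add: power2_eq_square mult_ac)
  also have "\<dots> dvd h^2"
    using root by (simp add: h_def dvd_power_same)
  also have "\<dots> dvd poly f (x + h) - (poly f x + h * poly (pderiv f) x)"
    by (rule poly_add_taylor_dvd)
  finally have "p ^ Suc (Suc n) dvd poly f (x + h) - (poly f x + h * poly (pderiv f) x)" .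
  moreover have "p ^ Suc n * p dvd poly f x * (1 - s * poly (pderiv f) x)"
    using root inverse by (rule mult_dvd_mono)
  then have "p ^ Suc (Suc n) dvd poly f x + h * poly (pderiv f) x"
    by (simp add: h_def algebra_simps)
  ultimately have "p ^ Suc (Suc n) dvd (poly f (x + h) - (poly f x + h * poly (pderiv f) x))
      + (poly f x + h * poly (pderiv f) x)"
    by (rule dvd_add)
  then show ?thesis by (simp add: newton_step_def h_def)
qed

lemma newton_iterate_dvd:
  assumes root: "p dvd poly f a" and inverse: "p dvd 1 - s * poly (pderiv f) a"
  shows "p ^ Suc n dvd poly f ((newton_step f s ^^ n) a) \<and> p dvd (newton_step f s ^^ n) a - a"
proof (induction n)
  case 0
  then show ?case using root by simp
next
  case (Suc n)
  define x where "x = (newton_step f s ^^ n) a"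
  have x: "p ^ Suc n dvd poly f x" "p dvd x - a"
    using Suc.IH by (simp_all add: x_def)
  have "p dvd poly (pderiv f) x - poly (pderiv f) a"
    using x(2) diff_dvd_poly_diff by (rule dvd_trans)
  then have "p dvd (1 - s * poly (pderiv f) a) - s * (poly (pderiv f) x - poly (pderiv f) a)"
    by (rule dvd_diff[OF inverse dvd_mult])
  then have "p dvd 1 - s * poly (pderiv f) x"
    by (simp add: algebra_simps)
  with x(1) have "p ^ Suc (Suc n) dvd poly f (newton_step f s x)"
    by (rule newton_step_dvd)
  moreover have "p dvd poly f x"
    using x(1) by (auto intro: dvd_mult_left)
  then have "p dvd (x - a) - s * poly f x"
    by (rule dvd_diff[OF x(2) dvd_mult])
  then have "p dvd newton_step f s x - a"
    by (simp add: newton_step_def algebra_simps)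
  ultimately show ?case by (simp add: x_def)
qed

theorem hensel:
  assumes "0 < p" and root: "int p dvd poly f a" and simple: "coprime (poly (pderiv f) a) (int p)"
  obtains x where "x \<in> padic_ints p" "x 1 = a mod int p" "\<And>n. int p ^ n dvd poly f (x n)"
proof -
  obtain s where "[poly (pderiv f) a * s = 1] (mod int p)"
    using cong_solve_coprime_int[OF simple] by blast
  then have s: "int p dvd 1 - s * poly (pderiv f) a"
    by (metis cong_iff_dvd_diff cong_sym mult.commute)
  define y where "y = (\<lambda>n. (newton_step f s ^^ n) a)"
  have y: "int p ^ Suc n dvd poly f (y n)" "int p dvd y n - a" for n
    using newton_iterate_dvd[OF root s, of n] by (simp_all add: y_def)
  have root_y: "int p ^ n dvd poly f (y n)" for n
    using y(1)[of n] by (auto intro: dvd_mult_right)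
  show thesis
  proof
    have "int p ^ n dvd y (Suc n) - y n" for n
      using root_y[of n] by (simp add: y_def newton_step_def)
    then show "(\<lambda>n. y n mod int p ^ n) \<in> padic_ints p"
      using \<open>0 < p\<close> by (simp add: padic_ints_def mod_mod_cancel mod_eq_dvd_iff)
    show "y 1 mod int p ^ 1 = a mod int p"
      using y(2)[of 1] by (simp add: mod_eq_dvd_iff)
    show "int p ^ n dvd poly f (y n mod int p ^ n)" for n
    proof -
      have "int p ^ n dvd y n mod int p ^ n - y n"
        by (simp flip: mod_eq_dvd_iff)
      then have "int p ^ n dvd poly f (y n mod int p ^ n) - poly f (y n)"
        using diff_dvd_poly_diff by (rule dvd_trans)
      then have "int p ^ n dvd (poly f (y n mod int p ^ n) - poly f (y n)) + poly f (y n)"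
        using root_y by (rule dvd_add)
      then show ?thesis by simp
    qed
  qed
qed

definition padic_square :: "nat \<Rightarrow> int \<Rightarrow> bool" where
  "padic_square p k \<longleftrightarrow> (\<exists>r\<in>padic_ints p. padic_mult p r r = padic_of_int p k)"

lemma padic_square_if_square_mod_prime:
  assumes "prime p" and root: "int p dvd a^2 - k" and "\<not> int p dvd 2 * k"
  shows "padic_square p k"
proof -
  let ?f = "[:-k, 0, 1:]"
  have "\<not> int p dvd a"
    using assms by (auto simp: dvd_diff_right_iff power2_eq_square)
  then have "\<not> int p dvd 2 * a"
    using assms by (auto simp: prime_dvd_mult_iff)
  then have "coprime (int p) (2 * a)"
    using \<open>prime p\<close> by (intro prime_imp_coprime) auto
  then have simple: "coprime (poly (pderiv ?f) a) (int p)"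
    by (simp only: coprime_commute) (simp add: pderiv_pCons mult_ac)
  have "int p dvd poly ?f a"
    using root by (simp add: algebra_simps power2_eq_square)
  then obtain r where "r \<in> padic_ints p" "\<And>n. int p ^ n dvd poly ?f (r n)"
    using hensel[OF prime_gt_0_nat[OF \<open>prime p\<close>] _ simple] by blast
  then show ?thesis
    unfolding padic_square_def by (intro bexI[of _ r])
      (auto simp: padic_mult_def padic_of_int_def mod_eq_dvd_iff algebra_simps)
qed

theorem infinite_primes_padic_square:
  assumes "k \<noteq> 0"
  shows "infinite {p. prime p \<and> padic_square p k}"
proof -
  let ?D = "{p::nat. prime p \<and> (\<exists>a. int p dvd poly [:-k, 0, 1:] a)}"
  have "poly [:-k, 0, 1:] a = a^2 - k" for a
    by (simp add: power2_eq_square)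
  then have "?D - {p. int p dvd 2 * k} \<subseteq> {p. prime p \<and> padic_square p k}"
    using padic_square_if_square_mod_prime by auto
  moreover have "finite {p. int p dvd 2 * k}"
    using finite_vimageI[OF finite_divisors_int[of "2 * k"], of int] assms by (simp add: vimage_def)
  then have "infinite (?D - {p. int p dvd 2 * k})"
    using infinite_prime_divisors_poly[of "[:-k, 0, 1:]"] by (intro Diff_infinite_finite) auto
  ultimately show ?thesis by (rule infinite_super)
qed

corollary ex_prime_padic_square:
  assumes "k \<noteq> 0" "finite T"
  obtains p where "prime p" "p \<notin> T" "padic_square p k"
proof -
  have "infinite ({p. prime p \<and> padic_square p k} - T)"
    using assms by (intro Diff_infinite_finite infinite_primes_padic_square)
  then show thesis
    using that by (auto dest!: infinite_imp_nonempty)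
qed

section \<open>Local points and their approximation\<close>

lemma padic_of_int_in_padic_ints: "0 < p \<Longrightarrow> padic_of_int p k \<in> padic_ints p"
  by (simp add: padic_ints_def padic_of_int_def mod_mod_cancel)

lemma padic_mult_in_padic_ints:
  assumes "0 < p" "x \<in> padic_ints p" "y \<in> padic_ints p"
  shows "padic_mult p x y \<in> padic_ints p"
proof -
  have "(x (Suc n) * y (Suc n)) mod int p ^ n = (x n * y n) mod int p ^ n" for n
  proof -
    have "x n = x (Suc n) mod int p ^ n" "y n = y (Suc n) mod int p ^ n"
      using assms by (simp_all add: padic_ints_def)
    then show ?thesis by (simp only: mod_mult_eq)
  qed
  then show ?thesis using assms(1)
    by (simp add: padic_ints_def padic_mult_def mod_mod_cancel)
qed

lemma Um_Zp_axis_points: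
  assumes "0 < p" "r \<in> padic_ints p" "padic_mult p r r = padic_of_int p m"
  shows "(r, padic_of_int p 0, padic_of_int p 0) \<in> Um_Zp m p"
    and "(padic_of_int p 0, r, padic_of_int p 0) \<in> Um_Zp m p"
  using assms padic_of_int_in_padic_ints[of p 0]
  by (auto simp: Um_Zp_def markoff_padic_def padic_sub_def padic_add_def padic_mult_def
      padic_of_int_def fun_eq_iff)

lemma Um_Zp_0_isotropic_point:
  assumes "0 < p" "r \<in> padic_ints p" and square: "padic_mult p r r = padic_of_int p (-1)"
  shows "(padic_of_int p 0, padic_of_int p k, padic_mult p (padic_of_int p k) r) \<in> Um_Zp 0 p"
proof -
  have "int p ^ n dvd 1 + r n * r n" for n
    using square
    by (simp add: padic_mult_def padic_of_int_def fun_eq_iff mod_eq_dvd_iff add.commute)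
  then have "int p ^ n dvd k * k * (1 + r n * r n)" for n
    by (rule dvd_mult)
  then have "markoff_padic p (padic_of_int p 0) (padic_of_int p k)
      (padic_mult p (padic_of_int p k) r) = padic_of_int p 0"
    by (simp add: markoff_padic_def padic_sub_def padic_add_def padic_mult_def padic_of_int_def
        fun_eq_iff mod_simps) (simp add: algebra_simps)
  then show ?thesis
    using assms(1,2) by (simp add: Um_Zp_def padic_of_int_in_padic_ints padic_mult_in_padic_ints)
qed

lemma topspace_padic_topology: "topspace (padic_topology p) = padic_ints p"
  by (auto simp: padic_topology_def topology_generated_by_topspace)

lemma openin_padic_ball:
  "x \<in> padic_ints p \<Longrightarrow> openin (padic_topology p) {y \<in> padic_ints p. y n = x n}"
  unfolding padic_topology_def by (rule topology_generated_by_Basis) auto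

lemma topspace_Um_Zp_topology: "topspace (Um_Zp_topology m p) = Um_Zp m p"
  by (auto simp: Um_Zp_topology_def topspace_padic_topology Um_Zp_def)

definition Um_Zp_ball ::
  "int \<Rightarrow> nat \<Rightarrow> nat \<Rightarrow> (nat \<Rightarrow> int) \<times> (nat \<Rightarrow> int) \<times> (nat \<Rightarrow> int) \<Rightarrow>
    ((nat \<Rightarrow> int) \<times> (nat \<Rightarrow> int) \<times> (nat \<Rightarrow> int)) set" where
  "Um_Zp_ball m p n = (\<lambda>(a, b, c). {(x, y, z) \<in> Um_Zp m p. x n = a n \<and> y n = b n \<and> z n = c n})"

lemma centre_in_Um_Zp_ball: "w \<in> Um_Zp m p \<Longrightarrow> w \<in> Um_Zp_ball m p n w"
  by (auto simp: Um_Zp_ball_def)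

lemma openin_Um_Zp_ball:
  assumes "w \<in> Um_Zp m p"
  shows "openin (Um_Zp_topology m p) (Um_Zp_ball m p n w)"
proof -
  obtain a b c where w: "w = (a, b, c)" by (rule prod_cases3)
  let ?B = "\<lambda>a. {y \<in> padic_ints p. y n = a n}"
  let ?X = "padic_topology p"
  have "openin (prod_topology ?X (prod_topology ?X ?X)) (?B a \<times> ?B b \<times> ?B c)"
    using assms by (auto simp: w openin_prod_Times_iff Um_Zp_def intro!: openin_padic_ball)
  then have "openin (Um_Zp_topology m p) (Um_Zp m p \<inter> (?B a \<times> ?B b \<times> ?B c))"
    unfolding Um_Zp_topology_def by (rule openin_subtopology_Int2)
  moreover have "Um_Zp m p \<inter> (?B a \<times> ?B b \<times> ?B c) = Um_Zp_ball m p n w"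
    by (auto simp: w Um_Zp_ball_def Um_Zp_def)
  ultimately show ?thesis by simp
qed

definition diagonal_dense :: "int \<Rightarrow> nat set \<Rightarrow> bool" where
  "diagonal_dense m I \<longleftrightarrow>
     product_topology (Um_Zp_topology m) I closure_of (diag_map I ` Um_Z m)
       = topspace (product_topology (Um_Zp_topology m) I)"

lemma diagonal_dense_imp_approximation:
  assumes dense: "diagonal_dense m I" and soluble: "\<forall>p\<in>I. Um_Zp m p \<noteq> {}"
    and "finite F" "F \<subseteq> I" and local_points: "\<forall>p\<in>F. (a p, b p, c p) \<in> Um_Zp m p"
  obtains x y z where "(x, y, z) \<in> Um_Z m"
    "\<And>p. p \<in> F \<Longrightarrow> x mod int p ^ n = a p n \<and> y mod int p ^ n = b p n \<and> z mod int p ^ n = c p n"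
proof -
  define U where
    "U = (\<lambda>p. if p \<in> F then Um_Zp_ball m p n (a p, b p, c p) else topspace (Um_Zp_topology m p))"
  have "openin (product_topology (Um_Zp_topology m) I) (PiE I U)"
  proof -
    have "finite {p \<in> I. U p \<noteq> topspace (Um_Zp_topology m p)}"
      by (rule finite_subset[OF _ \<open>finite F\<close>]) (auto simp: U_def)
    then show ?thesis
      using local_points by (auto simp: openin_PiE_gen U_def openin_Um_Zp_ball)
  qed
  moreover have "U p \<noteq> {}" if "p \<in> I" for p
    using soluble local_points that centre_in_Um_Zp_ball[of "(a p, b p, c p)" m p n]
    by (auto simp: U_def topspace_Um_Zp_topology)
  then have "PiE I U \<noteq> {}"
    by (simp add: PiE_eq_empty_iff)
  ultimately have "diag_map I ` Um_Z m \<inter> PiE I U \<noteq> {}"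
    using dense unfolding diagonal_dense_def dense_intersects_open by blast
  then obtain x y z where "(x, y, z) \<in> Um_Z m" and U: "diag_map I (x, y, z) \<in> PiE I U" by auto
  moreover have "x mod int p ^ n = a p n \<and> y mod int p ^ n = b p n \<and> z mod int p ^ n = c p n"
    if "p \<in> F" for p
    using PiE_mem[OF U, of p] that \<open>F \<subseteq> I\<close>
    by (auto simp: U_def Um_Zp_ball_def diag_map_def padic_of_int_def)
  ultimately show thesis using that by blast
qed

section \<open>Failure of density\<close>

lemma not_diagonal_dense_if_square_at_two_primes:
  assumes "m \<noteq> 0" and soluble: "\<forall>p\<in>I. Um_Zp m p \<noteq> {}"
    and "p \<in> I" "q \<in> I" "p \<noteq> q" and large: "\<bar>m\<bar> + 4 \<le> int p" "\<bar>m\<bar> + 4 \<le> int q"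
    and square: "padic_square p m" "padic_square q m"
  shows "\<not> diagonal_dense m I"
proof
  assume dense: "diagonal_dense m I"
  obtain r s where r: "r \<in> padic_ints p" "padic_mult p r r = padic_of_int p m"
    and s: "s \<in> padic_ints q" "padic_mult q s s = padic_of_int q m"
    using square by (auto simp: padic_square_def)
  define zero :: "nat \<Rightarrow> nat \<Rightarrow> int" where "zero = (\<lambda>p. padic_of_int p 0)"
  have "0 < p" "0 < q"
    using large by auto
  then have "(r, zero p, zero p) \<in> Um_Zp m p" "(zero q, s, zero q) \<in> Um_Zp m q"
    using r s by (simp_all add: zero_def Um_Zp_axis_points)
  then have "\<forall>i\<in>{p, q}. ((zero(p := r)) i, (zero(q := s)) i, zero i) \<in> Um_Zp m i"
    using \<open>p \<noteq> q\<close> by auto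
  then obtain x y z where xyz: "(x, y, z) \<in> Um_Z m" and approx: "\<And>i. i \<in> {p, q} \<Longrightarrow>
      x mod int i ^ 1 = (zero(p := r)) i 1 \<and> y mod int i ^ 1 = (zero(q := s)) i 1 \<and>
      z mod int i ^ 1 = zero i 1"
    using diagonal_dense_imp_approximation[OF dense soluble, of "{p, q}"] assms(3,4) by blast
  have "int p dvd y \<and> int p dvd z \<and> int q dvd x \<and> int q dvd z"
    using approx[of p] approx[of q] \<open>p \<noteq> q\<close>
    by (auto simp: zero_def padic_of_int_def mod_eq_0_iff_dvd)
  then show False
    using Um_Z_not_dvd_near_two_axes[OF \<open>m \<noteq> 0\<close> xyz large] by contradiction
qed

lemma not_diagonal_dense_0_if_minus_1_square:
  assumes soluble: "\<forall>p\<in>I. Um_Zp 0 p \<noteq> {}" and "p \<in> I" and "4 \<le> p"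
    and "padic_square p (-1)"
  shows "\<not> diagonal_dense 0 I"
proof
  assume dense: "diagonal_dense 0 I"
  obtain r where r: "r \<in> padic_ints p" "padic_mult p r r = padic_of_int p (-1)"
    using \<open>padic_square p (-1)\<close> by (auto simp: padic_square_def)
  let ?p = "padic_of_int p (int p)"
  have local_point: "\<forall>i\<in>{p}. (padic_of_int p 0, ?p, padic_mult p ?p r) \<in> Um_Zp 0 i"
    using Um_Zp_0_isotropic_point[OF _ r, of "int p"] \<open>4 \<le> p\<close> by simp
  have "finite {p}" "{p} \<subseteq> I"
    using \<open>p \<in> I\<close> by simp_all
  from diagonal_dense_imp_approximation[OF dense soluble this local_point, where n = 2]
  obtain x y z where xyz: "(x, y, z) \<in> Um_Z 0" and approx: "\<And>i. i \<in> {p} \<Longrightarrow>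
      x mod int i ^ 2 = padic_of_int p 0 2 \<and> y mod int i ^ 2 = ?p 2 \<and>
      z mod int i ^ 2 = padic_mult p ?p r 2"
    by blast
  have x: "x mod int p ^ 2 = 0" and y: "y mod int p ^ 2 = int p mod int p ^ 2"
    and z: "z mod int p ^ 2 = int p * r 2 mod int p ^ 2"
    using approx[of p] by (simp_all add: padic_of_int_def padic_mult_def mod_simps)
  have "p < p^2"
    using \<open>4 \<le> p\<close> by (simp add: power2_eq_square)
  then have "y mod int p ^ 2 = int p"
    using y by (simp flip: of_nat_power)
  then have "y \<noteq> 0"
    using \<open>4 \<le> p\<close> by auto
  moreover have dvd_mod: "int p dvd t mod int p ^ 2 \<longleftrightarrow> int p dvd t" for t
    by (intro dvd_mod_iff) simp
  have "int p dvd x mod int p ^ 2" "int p dvd y mod int p ^ 2" "int p dvd z mod int p ^ 2"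
    unfolding x y z dvd_mod by simp_all
  then have "int p dvd x" "int p dvd y" "int p dvd z"
    unfolding dvd_mod by simp_all
  ultimately show False
    using Um_Z_0_dvd_imp_origin[OF xyz, of "int p"] \<open>4 \<le> p\<close> by simp
qed

theorem theorem6p2:
  fixes m :: int and S :: "nat set"
  assumes "Um_R m \<noteq> {}"
    and "\<forall>p. prime p \<longrightarrow> Um_Zp m p \<noteq> {}"
    and "finite S" and "\<forall>p\<in>S. prime p"
  shows "product_topology (Um_Zp_topology m) {p. prime p \<and> p \<notin> S}
           closure_of (diag_map {p. prime p \<and> p \<notin> S} ` Um_Z m)
         \<noteq> topspace (product_topology (Um_Zp_topology m) {p. prime p \<and> p \<notin> S})"
proof -
  let ?I = "{p. prime p \<and> p \<notin> S}"
  define T where "T = S \<union> {..<nat (\<bar>m\<bar> + 4)}"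
  have "finite T"
    using \<open>finite S\<close> by (simp add: T_def)
  have large: "p \<in> ?I \<and> \<bar>m\<bar> + 4 \<le> int p" if "prime p" "p \<notin> T" for p
    using that by (auto simp: T_def)
  have soluble: "\<forall>p\<in>?I. Um_Zp m p \<noteq> {}"
    using assms(2) by simp
  have "\<not> diagonal_dense m ?I"
  proof (cases "m = 0")
    case True
    obtain p where "prime p" "p \<notin> T" "padic_square p (-1)"
      using ex_prime_padic_square[OF _ \<open>finite T\<close>, of "-1"] by auto
    then show ?thesis
      using True soluble large[of p] not_diagonal_dense_0_if_minus_1_square[of ?I p] by simp
  next
    case False
    obtain p where p: "prime p" "p \<notin> T" "padic_square p m"
      using ex_prime_padic_square[OF False \<open>finite T\<close>] by blast
    obtain q where q: "prime q" "q \<notin> insert p T" "padic_square q m"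
      using ex_prime_padic_square[OF False, of "insert p T"] \<open>finite T\<close> by blast
    show ?thesis
      using False soluble p q large[of p] large[of q]
      by (intro not_diagonal_dense_if_square_at_two_primes[of m ?I p q]) auto
  qed
  then show ?thesis by (simp add: diagonal_dense_def)
qed

end
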